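(* Let $x>0$ and let $P$ be a parallelogram with adjacent side lengths $1$ and $x$. For each positive integer $n$, let $f(n)$ be the maximum of $a_1+\cdots+a_n$ over all packings inside $P$ of $n$ non-overlapping parallelograms similar to $P$, the $i$-th having side lengths $a_i$ and $a_i x$ (corresponding under the similarity to the sides $1$ and $x$ of $P$). For each positive integer $k$ let $\epsilon(k):=f(k^2+1)-k$. Then $f(k^2+1)=k$ for all positive integers $k$ if and only if the series $\sum_{k\geqslant 1}\epsilon(k)$ converges. Additionally, if $f(k^2+1)=k$ for infinitely many positive integers $k$, then $f(k^2+1)=k$ for all positive integers $k$.
   Context: A packing of $n$ non-overlapping parallelograms inside $P$ means $n$ parallelograms contained in the (closed) parallelogram $P$ with pairwise disjoint interiors. The small parallelograms are similar to $P$ (the $i$-th being the image of $P$ under a similarity of the plane with ratio $a_i>0$) and may have different sizes, positions and orientations. *)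

theory Defs
  imports "HOL-Analysis.Analysis"
begin

definition parallelogram :: "real^2 \<Rightarrow> real^2 \<Rightarrow> real^2 \<Rightarrow> (real^2) set" where
  "parallelogram p u v = {p + s *\<^sub>R u + t *\<^sub>R v | s t. 0 \<le> s \<and> s \<le> 1 \<and> 0 \<le> t \<and> t \<le> 1}"

(* The condition u \<noteq> v is not redundant: independent {u, v} also holds when u = v \<noteq> 0. *)
definition parallelogram_with_sides :: "real \<Rightarrow> real \<Rightarrow> (real^2) set \<Rightarrow> bool" where
  "parallelogram_with_sides l m P \<longleftrightarrow>
     (\<exists>p u v. u \<noteq> v \<and> independent {u, v} \<and> norm u = l \<and> norm v = m \<and> P = parallelogram p u v)"

(* Orientation-reversing similarities are included. *)
definition similarity :: "real \<Rightarrow> (real^2 \<Rightarrow> real^2) \<Rightarrow> bool" where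
  "similarity a T \<longleftrightarrow> a > 0 \<and> (\<forall>y z. dist (T y) (T z) = a * dist y z)"

definition similar_packing ::
  "(real^2) set \<Rightarrow> nat \<Rightarrow> (nat \<Rightarrow> real) \<Rightarrow> (nat \<Rightarrow> (real^2) set) \<Rightarrow> bool" where
  "similar_packing P n a Q \<longleftrightarrow>
     (\<forall>i<n. (\<exists>T. similarity (a i) T \<and> Q i = T ` P) \<and> Q i \<subseteq> P) \<and>
     (\<forall>i<n. \<forall>j<n. i \<noteq> j \<longrightarrow> interior (Q i) \<inter> interior (Q j) = {})"

(* The maximum is attained for n \<ge> 1: in a limit of packings some ratios may tend to 0, but a
   parallelogram of ratio a > 0 can be replaced by any number of homothetic copies placed along
   its diagonal whose ratios add up to a. *)
definition max_packing_sum :: "(real^2) set \<Rightarrow> nat \<Rightarrow> real" where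
  "max_packing_sum P n = (GREATEST s. \<exists>a Q. similar_packing P n a Q \<and> s = (\<Sum>i<n. a i))"

definition packing_excess :: "(real^2) set \<Rightarrow> nat \<Rightarrow> real" where
  "packing_excess P k = max_packing_sum P (k^2 + 1) - real k"

end

theory Submission
  imports Defs
begin

text \<open>
  Write \<open>\<epsilon> k = f (k\<^sup>2 + 1) - k\<close>. Everything follows from the fact that \<open>k \<mapsto> k * \<epsilon> k\<close> is
  nondecreasing (\<open>packing_excess_growth\<close>). For \<open>K \<ge> k\<close>, cut \<open>P\<close> into a \<open>K \<times> K\<close> grid of cells of
  ratio \<open>1/K\<close> and replace a corner block of \<open>k \<times> k\<close> cells, which is itself a copy of \<open>P\<close> of ratio
  \<open>k/K\<close>, by a scaled copy of an optimal packing with \<open>k\<^sup>2 + 1\<close> pieces. The result has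
  \<open>K\<^sup>2 - k\<^sup>2 + (k\<^sup>2 + 1) = K\<^sup>2 + 1\<close> pieces, and its sum is
  \<open>(K\<^sup>2 - k\<^sup>2)/K + (k/K)(k + \<epsilon> k) = K + (k/K) \<epsilon> k\<close>; this is \<open>achievable_grid\<close>. Moreover
  \<open>\<epsilon> 1 \<ge> 0\<close>, because two half-size copies of \<open>P\<close> fit along a diagonal, so all \<open>\<epsilon> k\<close> are
  nonnegative. If some \<open>\<epsilon> k\<close> is positive, then from \<open>k\<close> on all \<open>\<epsilon> K\<close> are positive and dominate
  a multiple of the harmonic series. So \<open>\<epsilon>\<close> has only finitely many zeros and a divergent sum.

  The remaining work is that the maximum defining \<open>f\<close> is attained
  (\<open>max_packing_sum_properties\<close>), without which the greatest element would be an unspecified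
  number. The maps \<open>T i\<close> that place the pieces are treated as points of a product of copies of the
  plane, one for each point of the plane, where Tychonoff's theorem gives compactness. The packing
  conditions become closed if ratio \<open>0\<close> is admitted and disjointness of interiors is expressed
  through balls contained in \<open>P\<close> (\<open>weak_packing\<close>). In a maximizer some ratios may vanish. These
  pieces are dropped, and the number of pieces is restored without changing the sum by splitting a
  piece into two halves along its diagonal (\<open>achievable_Suc\<close>).
\<close>

section \<open>Similarities of the plane\<close>

lemma similarity_affine:
  assumes "similarity a T"
  obtains L where "linear L" "inj L" "T = (\<lambda>z. T 0 + L z)"
proof
  define L where "L = (\<lambda>z. T z - T 0)"
  have a: "a > 0" and d: "\<And>y z. dist (T y) (T z) = a * dist y z"
    using assms by (auto simp: similarity_def)
  have dL: "dist (L y) (L z) = a * dist y z" for y z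
    using d[of y z] by (simp add: L_def dist_norm)
  show "linear L"
    by (rule scaling_linear[where c = a]) (use dL in \<open>auto simp: L_def\<close>)
  show "inj L"
  proof (rule injI)
    fix y z assume "L y = L z"
    then show "y = z" using dL[of y z] a by simp
  qed
  show "T = (\<lambda>z. T 0 + L z)"
    by (simp add: L_def)
qed

lemma interior_similarity_image:
  assumes "similarity a T"
  shows "interior (T ` S) = T ` interior S"
proof -
  obtain L where L: "linear L" "inj L" and T: "T = (\<lambda>z. T 0 + L z)"
    using similarity_affine[OF assms] .
  have im: "T ` A = (+) (T 0) ` L ` A" for A
    using T by (metis image_image)
  show ?thesis
    unfolding im by (simp add: interior_translation interior_injective_linear_image[OF L])
qed

lemma inj_similarity:
  assumes "similarity a T"
  shows "inj T"
proof (rule injI)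
  fix y z assume "T y = T z"
  moreover have "dist (T y) (T z) = a * dist y z" "a > 0"
    using assms by (simp_all add: similarity_def)
  ultimately show "y = z" by simp
qed

lemma surj_similarity:
  assumes "similarity a T"
  shows "surj T"
proof -
  obtain L where L: "linear L" "inj L" and T: "T = (\<lambda>z. T 0 + L z)"
    using similarity_affine[OF assms] .
  have "surj L" by (rule linear_injective_imp_surjective[OF L refl])
  have "\<exists>z. y = T z" for y
  proof -
    obtain z where "y - T 0 = L z" using \<open>surj L\<close> by (meson surjD)
    moreover have "T z = T 0 + L z" using T by (rule fun_cong)
    ultimately have "y = T z" by (simp add: algebra_simps)
    then show ?thesis ..
  qed
  then show ?thesis by blast
qed

lemma similarity_compose:
  assumes "similarity a T" "similarity b S"
  shows "similarity (a * b) (T \<circ> S)"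
  using assms by (auto simp: similarity_def)

lemma similarity_image_ball:
  assumes "similarity a T" "dist (T w) z < a * r"
  shows "z \<in> T ` ball w r"
proof -
  obtain y where y: "z = T y" using surj_similarity[OF assms(1)] by (meson surjD)
  then have "a * dist w y < a * r" using assms by (simp add: similarity_def)
  then have "y \<in> ball w r" using assms(1) by (simp add: similarity_def)
  then show ?thesis using y by blast
qed

section \<open>Packings indexed by finite sets\<close>

text \<open>Keeping the similarities themselves instead of only the image sets, and allowing arbitrary
  index sets, makes packings easy to compose and to index by grid cells.\<close>
definition packing ::
  "(real^2) set \<Rightarrow> 'i set \<Rightarrow> ('i \<Rightarrow> real) \<Rightarrow> ('i \<Rightarrow> real^2 \<Rightarrow> real^2) \<Rightarrow> bool" where
  "packing P I a T \<longleftrightarrow>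
     (\<forall>i\<in>I. similarity (a i) (T i) \<and> T i ` P \<subseteq> P) \<and>
     (\<forall>i\<in>I. \<forall>j\<in>I. i \<noteq> j \<longrightarrow> interior (T i ` P) \<inter> interior (T j ` P) = {})"

definition achievable :: "(real^2) set \<Rightarrow> nat \<Rightarrow> real \<Rightarrow> bool" where
  "achievable P n s \<longleftrightarrow> (\<exists>a Q. similar_packing P n a Q \<and> s = (\<Sum>i<n. a i))"

lemma achievable_iff_packing:
  "achievable P n s \<longleftrightarrow> (\<exists>a T. packing P {..<n} a T \<and> s = (\<Sum>i<n. a i))"
proof
  assume "achievable P n s"
  then obtain a Q where p: "similar_packing P n a Q" and s: "s = (\<Sum>i<n. a i)"
    by (auto simp: achievable_def)
  from p have "\<forall>i. \<exists>T. i < n \<longrightarrow> similarity (a i) T \<and> Q i = T ` P"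
    by (auto simp: similar_packing_def)
  then obtain T where "\<forall>i. i < n \<longrightarrow> similarity (a i) (T i) \<and> Q i = T i ` P"
    by metis
  then have "packing P {..<n} a T"
    using p by (auto simp: packing_def similar_packing_def)
  then show "\<exists>a T. packing P {..<n} a T \<and> s = (\<Sum>i<n. a i)" using s by blast
next
  assume "\<exists>a T. packing P {..<n} a T \<and> s = (\<Sum>i<n. a i)"
  then obtain a T where "packing P {..<n} a T" and s: "s = (\<Sum>i<n. a i)" by blast
  then have "similar_packing P n a (\<lambda>i. T i ` P)"
    unfolding packing_def similar_packing_def by blast
  then show "achievable P n s" using s by (auto simp: achievable_def)
qed

lemma packing_reindex:
  assumes "packing P I a T" "bij_betw h J I"
  shows "packing P J (a \<circ> h) (T \<circ> h)"
proof -
  have I: "h j \<in> I" if "j \<in> J" for j using assms(2) that by (rule bij_betw_apply)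
  have inj: "h i \<noteq> h j" if "i \<in> J" "j \<in> J" "i \<noteq> j" for i j
    using assms(2) that by (auto simp: bij_betw_def inj_on_def)
  show ?thesis
    using assms(1) I inj unfolding packing_def comp_apply by meson
qed

lemma packing_achievable:
  assumes "packing P I a T" "finite I"
  shows "achievable P (card I) (sum a I)"
proof -
  obtain h where h: "bij_betw h {..<card I} I"
    using ex_bij_betw_nat_finite[OF \<open>finite I\<close>] by (auto simp: atLeast0LessThan)
  have "sum a I = (\<Sum>i<card I. (a \<circ> h) i)"
    using sum.reindex_bij_betw[OF h, of a] by simp
  then show ?thesis
    unfolding achievable_iff_packing using packing_reindex[OF assms(1) h] by blast
qed

text \<open>The common source of all new packings: a piece \<open>T i0 ` P\<close> is similar to \<open>P\<close>, so any packing of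
  \<open>P\<close> can be carried into it by \<open>T i0\<close>.\<close>
lemma packing_substitute:
  assumes T: "packing P I a T" and "i0 \<in> I" and "finite I" and m: "achievable P m s"
  shows "achievable P (card I - 1 + m) (sum a I - a i0 + a i0 * s)"
proof -
  obtain b S where S: "packing P {..<m} b S" and s: "s = (\<Sum>j<m. b j)"
    using m by (auto simp: achievable_iff_packing)
  define I' where "I' = (I - {i0}) <+> {..<m}"
  define c where "c = case_sum a (\<lambda>j. a i0 * b j)"
  define U where "U = case_sum T (\<lambda>j. T i0 \<circ> S j)"
  have sT: "similarity (a i0) (T i0)" and TP: "T i0 ` P \<subseteq> P"
    using T \<open>i0 \<in> I\<close> by (auto simp: packing_def)
  have sub: "interior ((T i0 \<circ> S j) ` P) \<subseteq> interior (T i0 ` P)" if "j < m" for j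
    using S that by (intro interior_mono) (auto simp: packing_def image_comp[symmetric])
  have inner: "interior ((T i0 \<circ> S j) ` P) \<inter> interior ((T i0 \<circ> S k) ` P) = {}"
    if "j < m" "k < m" "j \<noteq> k" for j k
  proof -
    have "interior (S j ` P) \<inter> interior (S k ` P) = {}"
      using S that by (auto simp: packing_def)
    then show ?thesis
      unfolding image_comp[symmetric] interior_similarity_image[OF sT]
        image_Int[OF inj_similarity[OF sT], symmetric]
      by simp
  qed
  have outer: "interior (T i ` P) \<inter> interior ((T i0 \<circ> S j) ` P) = {}"
    if "i \<in> I - {i0}" "j < m" for i j
    using sub[OF \<open>j < m\<close>] T that \<open>i0 \<in> I\<close> unfolding packing_def by blast
  have S': "similarity (b j) (S j)" "S j ` P \<subseteq> P" if "j < m" for j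
    using S that by (auto simp: packing_def)
  have T': "similarity (a i) (T i)" "T i ` P \<subseteq> P" if "i \<in> I" for i
    using T that by (auto simp: packing_def)
  have "packing P I' c U"
    unfolding packing_def
  proof (intro conjI ballI impI)
    fix i assume i: "i \<in> I'"
    show "similarity (c i) (U i)"
    proof (cases i)
      case (Inl j)
      then show ?thesis using i T'(1) by (auto simp: I'_def c_def U_def)
    next
      case (Inr j)
      then show ?thesis
        using i similarity_compose[OF sT S'(1)] by (auto simp: I'_def c_def U_def)
    qed
    show "U i ` P \<subseteq> P"
    proof (cases i)
      case (Inl j)
      then show ?thesis using i T'(2) by (auto simp: I'_def U_def)
    next
      case (Inr j)
      then have "S j ` P \<subseteq> P" using i S'(2) by (auto simp: I'_def)
      then show ?thesis using TP Inr by (auto simp: U_def)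
    qed
  next
    fix i j assume ij: "i \<in> I'" "j \<in> I'" "i \<noteq> j"
    show "interior (U i ` P) \<inter> interior (U j ` P) = {}"
    proof (cases i; cases j)
      fix x y assume "i = Inl x" "j = Inl y"
      then have "x \<in> I" "y \<in> I" "x \<noteq> y" using ij by (auto simp: I'_def)
      then have "interior (T x ` P) \<inter> interior (T y ` P) = {}"
        using T by (simp add: packing_def)
      then show ?thesis using \<open>i = Inl x\<close> \<open>j = Inl y\<close> by (simp add: U_def)
    next
      fix x y assume "i = Inl x" "j = Inr y"
      then show ?thesis using ij outer[of x y] by (simp add: I'_def U_def Plus_def image_iff)
    next
      fix x y assume "i = Inr x" "j = Inl y"
      then show ?thesis
        using ij outer[of y x] by (simp add: I'_def U_def Plus_def image_iff Int_commute)
    next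
      fix x y assume "i = Inr x" "j = Inr y"
      then show ?thesis using ij inner[of x y] by (simp add: I'_def U_def Plus_def image_iff)
    qed
  qed
  moreover have "finite I'" using \<open>finite I\<close> by (simp add: I'_def)
  ultimately have "achievable P (card I') (sum c I')" by (rule packing_achievable)
  moreover have "card I' = card I - 1 + m"
    using \<open>finite I\<close> \<open>i0 \<in> I\<close> by (simp add: I'_def card_Plus)
  moreover have "sum c I' = sum a I - a i0 + a i0 * s"
    using \<open>finite I\<close> \<open>i0 \<in> I\<close>
    by (simp add: I'_def c_def s sum.Plus sum_diff1 sum_distrib_left comp_def)
  ultimately show ?thesis by simp
qed

section \<open>Homothetic copies of a parallelogram\<close>

lemma interiors_disjoint_of_separated:
  fixes A B :: "'a::euclidean_space set"
  assumes "w \<noteq> 0" "\<And>z. z \<in> A \<Longrightarrow> w \<bullet> z \<le> b" "\<And>z. z \<in> B \<Longrightarrow> b \<le> w \<bullet> z"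
  shows "interior A \<inter> interior B = {}"
proof -
  have "interior A \<subseteq> interior {z. w \<bullet> z \<le> b}"
    by (rule interior_mono) (use assms in blast)
  moreover have "interior B \<subseteq> interior {z. w \<bullet> z \<ge> b}"
    by (rule interior_mono) (use assms in blast)
  ultimately show ?thesis using \<open>w \<noteq> 0\<close> by force
qed

text \<open>Used twice, with the roles of \<open>u\<close> and \<open>v\<close> exchanged, this gives linear functionals that read off
  the coordinates with respect to \<open>u\<close> and \<open>v\<close>; they separate copies lying in different cells.\<close>
lemma dual_vector:
  fixes u v :: "real^2"
  assumes "u \<noteq> v" "independent {u, v}"
  obtains w where "w \<bullet> u = 1" "w \<bullet> v = 0"
proof -
  define D where "D = u$1 * v$2 - u$2 * v$1"
  have nsp: "u \<notin> range (\<lambda>k. k *\<^sub>R v)" and "v \<noteq> 0"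
    using assms by (auto simp: independent_insert span_singleton)
  have "D \<noteq> 0"
  proof
    assume D: "D = 0"
    have "\<exists>k. u = k *\<^sub>R v"
    proof (cases "v$1 = 0")
      case True
      then have "v$2 \<noteq> 0" using \<open>v \<noteq> 0\<close> by (auto simp: vec_eq_iff forall_2)
      then have "u = (u$2 / v$2) *\<^sub>R v" using D True by (auto simp: vec_eq_iff forall_2 D_def)
      then show ?thesis ..
    next
      case False
      then have "u = (u$1 / v$1) *\<^sub>R v" using D by (auto simp: vec_eq_iff forall_2 D_def field_simps)
      then show ?thesis ..
    qed
    then show False using nsp by blast
  qed
  define w :: "real^2" where "w = (1 / D) *\<^sub>R vector [v$2, - v$1]"
  have "w \<bullet> u = D / D" "w \<bullet> v = 0"
    by (simp_all add: w_def inner_vec_def sum_2 vector_2 D_def field_simps)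
  then show ?thesis using \<open>D \<noteq> 0\<close> that[of w] by simp
qed

definition homothety ::
  "real^2 \<Rightarrow> real^2 \<Rightarrow> real^2 \<Rightarrow> real \<Rightarrow> real \<Rightarrow> real \<Rightarrow> real^2 \<Rightarrow> real^2" where
  "homothety p u v r s t z = p + r *\<^sub>R (z - p) + s *\<^sub>R u + t *\<^sub>R v"

lemma homothety_image:
  assumes "y \<in> homothety p u v r s t ` parallelogram p u v" "r > 0"
  obtains s' t' where "y = p + s' *\<^sub>R u + t' *\<^sub>R v"
    "s \<le> s'" "s' \<le> s + r" "t \<le> t'" "t' \<le> t + r"
proof -
  obtain c d where cd: "0 \<le> c" "c \<le> 1" "0 \<le> d" "d \<le> 1"
    and y: "y = homothety p u v r s t (p + c *\<^sub>R u + d *\<^sub>R v)"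
    using assms(1) by (auto simp: parallelogram_def)
  have "y = p + (s + r * c) *\<^sub>R u + (t + r * d) *\<^sub>R v"
    by (simp add: y homothety_def algebra_simps)
  then show ?thesis
    by (rule that) (use cd \<open>r > 0\<close> in \<open>auto simp: mult_le_cancel_left1\<close>)
qed

text \<open>In the coordinates given by \<open>u\<close> and \<open>v\<close>, the copies are squares with lower left corner
  \<open>(s i, t i)\<close> and side \<open>r i\<close> in the unit square. Squares that do not overlap in one of the two
  coordinate directions are separated by a line.\<close>
lemma packing_homotheties:
  assumes uv: "u \<noteq> v" "independent {u, v}"
    and r: "\<And>i. i \<in> I \<Longrightarrow> r i > 0"
    and st: "\<And>i. i \<in> I \<Longrightarrow> 0 \<le> s i \<and> s i + r i \<le> 1 \<and> 0 \<le> t i \<and> t i + r i \<le> 1"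
    and sep: "\<And>i j. i \<in> I \<Longrightarrow> j \<in> I \<Longrightarrow> i \<noteq> j \<Longrightarrow>
      s i + r i \<le> s j \<or> s j + r j \<le> s i \<or> t i + r i \<le> t j \<or> t j + r j \<le> t i"
  shows "packing (parallelogram p u v) I r (\<lambda>i. homothety p u v (r i) (s i) (t i))"
    (is "packing ?P I r ?T")
proof -
  obtain w where w: "w \<bullet> u = 1" "w \<bullet> v = 0" using dual_vector[OF uv] .
  obtain w' where w': "w' \<bullet> v = 1" "w' \<bullet> u = 0"
    using dual_vector[of v u] uv by (metis insert_commute)
  have nz: "w \<noteq> 0" "w' \<noteq> 0" using w w' by auto
  have sim: "similarity (r i) (?T i)" if "i \<in> I" for i
  proof -
    have "dist (?T i y) (?T i z) = r i * dist y z" for y z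
    proof -
      have "?T i y - ?T i z = r i *\<^sub>R (y - z)" by (simp add: homothety_def algebra_simps)
      then show ?thesis using r[OF that] by (simp add: dist_norm)
    qed
    then show ?thesis using r[OF that] by (simp add: similarity_def)
  qed
  have coord: "s i \<le> w \<bullet> z - w \<bullet> p \<and> w \<bullet> z - w \<bullet> p \<le> s i + r i \<and>
      t i \<le> w' \<bullet> z - w' \<bullet> p \<and> w' \<bullet> z - w' \<bullet> p \<le> t i + r i"
    if i: "i \<in> I" and z: "z \<in> ?T i ` ?P" for i z
  proof -
    obtain c d where cd: "z = p + c *\<^sub>R u + d *\<^sub>R v"
      "s i \<le> c" "c \<le> s i + r i" "t i \<le> d" "d \<le> t i + r i"
      using homothety_image[OF z r[OF i]] by metis
    have "w \<bullet> z - w \<bullet> p = c" "w' \<bullet> z - w' \<bullet> p = d"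
      by (simp_all add: cd(1) inner_add_right w w')
    then show ?thesis using cd by simp
  qed
  have sub: "?T i ` ?P \<subseteq> ?P" if i: "i \<in> I" for i
  proof
    fix y assume y: "y \<in> ?T i ` ?P"
    then obtain c d where "y = p + c *\<^sub>R u + d *\<^sub>R v"
      "s i \<le> c" "c \<le> s i + r i" "t i \<le> d" "d \<le> t i + r i"
      using homothety_image[OF y r[OF i]] by metis
    moreover from this have "0 \<le> c" "c \<le> 1" "0 \<le> d" "d \<le> 1" using st[OF i] by linarith+
    ultimately show "y \<in> ?P" unfolding parallelogram_def by blast
  qed
  have le: "interior (?T i ` ?P) \<inter> interior (?T j ` ?P) = {}"
    if "i \<in> I" "j \<in> I" "s i + r i \<le> s j \<or> t i + r i \<le> t j" for i j
    using that(3)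
  proof
    assume le: "s i + r i \<le> s j"
    show ?thesis
      by (rule interiors_disjoint_of_separated[OF nz(1), where b = "s j + w \<bullet> p"])
        (use coord that(1,2) le in force)+
  next
    assume le: "t i + r i \<le> t j"
    show ?thesis
      by (rule interiors_disjoint_of_separated[OF nz(2), where b = "t j + w' \<bullet> p"])
        (use coord that(1,2) le in force)+
  qed
  show ?thesis
    unfolding packing_def
  proof (intro conjI ballI impI sim sub)
    fix i j assume "i \<in> I" "j \<in> I" "i \<noteq> j"
    with sep le show "interior (?T i ` ?P) \<inter> interior (?T j ` ?P) = {}"
      by (metis Int_commute)
  qed
qed

section \<open>Two operations on packings of a parallelogram\<close>

lemma achievable_halves:
  assumes "u \<noteq> v" "independent {u, v}"
  shows "achievable (parallelogram p u v) 2 1"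
proof -
  define c :: "bool \<Rightarrow> real" where "c = (\<lambda>b. if b then 1/2 else 0)"
  have "packing (parallelogram p u v) UNIV (\<lambda>_. 1/2) (\<lambda>b. homothety p u v (1/2) (c b) (c b))"
    by (rule packing_homotheties[OF assms]) (auto simp: c_def)
  from packing_achievable[OF this] have "achievable (parallelogram p u v) (card (UNIV :: bool set))
      (\<Sum>b\<in>(UNIV :: bool set). 1/2)"
    by simp
  moreover have "card (UNIV :: bool set) = 2" "(\<Sum>b\<in>(UNIV :: bool set). 1/2 :: real) = 1"
    by (simp_all add: UNIV_bool)
  ultimately show ?thesis by (simp only:)
qed

lemma achievable_Suc:
  assumes uv: "u \<noteq> v" "independent {u, v}"
    and "achievable (parallelogram p u v) n s" "n \<ge> 1"
  shows "achievable (parallelogram p u v) (Suc n) s"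
proof -
  obtain a T where T: "packing (parallelogram p u v) {..<n} a T" and s: "s = (\<Sum>i<n. a i)"
    using assms(3) by (auto simp: achievable_iff_packing)
  from packing_substitute[OF T _ _ achievable_halves[OF uv], of 0] show ?thesis
    using \<open>n \<ge> 1\<close> by (simp add: s)
qed

lemma achievable_mono:
  assumes "u \<noteq> v" "independent {u, v}"
    and "achievable (parallelogram p u v) m s" "1 \<le> m" "m \<le> n"
  shows "achievable (parallelogram p u v) n s"
  using \<open>m \<le> n\<close>
proof (induction n rule: dec_induct)
  case base
  show ?case by fact
next
  case (step n)
  then show ?case using achievable_Suc[OF assms(1,2)] \<open>1 \<le> m\<close> by simp
qed

text \<open>The key construction. In the index set of the initial packing, \<open>None\<close> stands for the corner
  block of ratio \<open>k/K\<close> and \<open>Some (i, j)\<close> for a grid cell of ratio \<open>1/K\<close> outside this block. The given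
  packing is then substituted for the block.\<close>
lemma achievable_grid:
  assumes uv: "u \<noteq> v" "independent {u, v}"
    and s: "achievable (parallelogram p u v) (k\<^sup>2 + 1) s"
    and k: "1 \<le> k" "k \<le> K"
  shows "achievable (parallelogram p u v) (K\<^sup>2 + 1) (real K + real k / real K * (s - real k))"
proof -
  define C where "C = {..<K} \<times> {..<K} - {..<k} \<times> {..<k}"
  define I where "I = insert None (Some ` C)"
  define r where "r = case_option (real k / real K) (\<lambda>_ :: nat \<times> nat. 1 / real K)"
  define c where "c = case_option 0 (\<lambda>(i, j :: nat). real i / real K)"
  define d where "d = case_option 0 (\<lambda>(i :: nat, j). real j / real K)"
  have K: "real K > 0" using k by simp
  have fin: "finite I" by (simp add: I_def C_def)
  have cardC: "card C = K\<^sup>2 - k\<^sup>2"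
    unfolding C_def using k by (subst card_Diff_subset) (auto simp: power2_eq_square)
  have step: "real i / real K + 1 / real K \<le> real j / real K \<longleftrightarrow> i < j" for i j :: nat
    using K by (simp add: divide_right_mono add_divide_distrib[symmetric] divide_le_cancel) auto
  have le1: "real i / real K + 1 / real K \<le> 1 \<longleftrightarrow> i < K" for i
    using K by (simp add: add_divide_distrib[symmetric]) auto
  have "packing (parallelogram p u v) I r (\<lambda>i. homothety p u v (r i) (c i) (d i))"
  proof (rule packing_homotheties[OF uv])
    fix i assume i: "i \<in> I"
    show "r i > 0" using k by (cases i) (auto simp: r_def)
    show "0 \<le> c i \<and> c i + r i \<le> 1 \<and> 0 \<le> d i \<and> d i + r i \<le> 1"
      using i k by (auto simp: I_def C_def r_def c_def d_def le1)
  next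
    fix i j assume "i \<in> I" "j \<in> I" "i \<noteq> j"
    then show "c i + r i \<le> c j \<or> c j + r j \<le> c i \<or> d i + r i \<le> d j \<or> d j + r j \<le> d i"
      using K by (auto simp: I_def C_def r_def c_def d_def step divide_le_cancel)
  qed
  from packing_substitute[OF this _ fin s, of None]
  have "achievable (parallelogram p u v) (card I - 1 + (k\<^sup>2 + 1))
      (sum r I - r None + r None * s)" by (simp add: I_def)
  moreover have "card I - 1 + (k\<^sup>2 + 1) = K\<^sup>2 + 1"
  proof -
    have "card I = Suc (card C)"
      unfolding I_def by (subst card_insert_disjoint) (auto simp: C_def card_image)
    moreover have "k\<^sup>2 \<le> K\<^sup>2" using k by simp
    ultimately show ?thesis using cardC by simp
  qed
  moreover have "sum r I - r None + r None * s = real K + real k / real K * (s - real k)"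
  proof -
    have "sum r I = r None + sum r (Some ` C)"
      unfolding I_def by (rule sum.insert) (auto simp: C_def)
    also have "sum r (Some ` C) = real (card C) / real K"
      by (subst sum.reindex) (auto simp: r_def)
    also have "real (card C) = (real K)\<^sup>2 - (real k)\<^sup>2"
      using k by (simp add: cardC of_nat_diff)
    finally show ?thesis using K by (simp add: r_def field_simps power2_eq_square)
  qed
  ultimately show ?thesis by (simp only:)
qed

section \<open>The maximum is attained\<close>

text \<open>A weakening of packings that survives pointwise limits. A ratio may be \<open>0\<close>. A similarity of
  ratio \<open>a\<close> maps \<open>ball w r\<close> onto \<open>ball (T w) (a * r)\<close>, so the second conjunct says that such
  image balls, for balls inside \<open>P\<close>, have no common point \<open>z\<close>. For positive ratios this is
  disjointness of interiors, but now for each choice of \<open>w\<close>, \<open>r\<close>, \<open>w'\<close>, \<open>r'\<close>, \<open>z\<close> it is a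
  disjunction of two non-strict inequalities between continuous functions of \<open>a\<close> and \<open>T\<close>, hence
  closed.\<close>
definition weak_packing ::
  "(real^2) set \<Rightarrow> nat \<Rightarrow> (nat \<Rightarrow> real) \<Rightarrow> (nat \<Rightarrow> real^2 \<Rightarrow> real^2) \<Rightarrow> bool" where
  "weak_packing P n a T \<longleftrightarrow>
     (\<forall>i<n. (\<forall>y z. dist (T i y) (T i z) = a i * dist y z) \<and> (\<forall>z\<in>P. T i z \<in> P)) \<and>
     (\<forall>i<n. \<forall>j<n. i \<noteq> j \<longrightarrow> (\<forall>w r w' r' z. ball w r \<subseteq> P \<longrightarrow> ball w' r' \<subseteq> P \<longrightarrow>
        a i * r \<le> dist (T i w) z \<or> a j * r' \<le> dist (T j w') z))"

lemma packing_imp_weak_packing: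
  assumes "packing P {..<n} a T"
  shows "weak_packing P n a T"
proof -
  have sim: "similarity (a i) (T i)" if "i < n" for i
    using assms that by (simp add: packing_def)
  have "a i * r \<le> dist (T i w) z \<or> a j * r' \<le> dist (T j w') z"
    if "i < n" "j < n" "i \<noteq> j" "ball w r \<subseteq> P" "ball w' r' \<subseteq> P" for i j w r w' r' z
  proof (rule ccontr)
    have ball: "ball w r \<subseteq> interior P" "ball w' r' \<subseteq> interior P"
      using that by (simp_all add: interior_maximal)
    assume "\<not> ?thesis"
    then have "z \<in> T i ` ball w r" "z \<in> T j ` ball w' r'"
      using sim that similarity_image_ball by (meson not_le)+
    then have "z \<in> interior (T i ` P)" "z \<in> interior (T j ` P)"
      using ball interior_similarity_image[OF sim] that by blast+
    moreover have "interior (T i ` P) \<inter> interior (T j ` P) = {}"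
      using assms that by (simp add: packing_def)
    ultimately show False by blast
  qed
  moreover have "\<forall>i<n. (\<forall>y z. dist (T i y) (T i z) = a i * dist y z) \<and> (\<forall>z\<in>P. T i z \<in> P)"
    using assms by (simp add: packing_def similarity_def image_subset_iff)
  ultimately show ?thesis unfolding weak_packing_def by blast
qed

lemma weak_packing_imp_packing:
  assumes "weak_packing P n a T"
  shows "packing P {i. i < n \<and> a i > 0} a T"
  unfolding packing_def
proof (intro conjI ballI impI)
  fix i assume i: "i \<in> {i. i < n \<and> a i > 0}"
  then show sim: "similarity (a i) (T i)" and "T i ` P \<subseteq> P"
    using assms by (auto simp: weak_packing_def similarity_def)
  fix j assume j: "j \<in> {i. i < n \<and> a i > 0}" and "i \<noteq> j"
  then have sim': "similarity (a j) (T j)"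
    using assms by (auto simp: weak_packing_def similarity_def)
  show "interior (T i ` P) \<inter> interior (T j ` P) = {}"
  proof (rule ccontr)
    assume "\<not> ?thesis"
    then obtain w w' where w: "w \<in> interior P" "w' \<in> interior P" and eq: "T i w = T j w'"
      by (auto simp: interior_similarity_image[OF sim] interior_similarity_image[OF sim'])
    then obtain r r' where "r > 0" "ball w r \<subseteq> P" "r' > 0" "ball w' r' \<subseteq> P"
      by (meson mem_interior)
    then have "a i * r \<le> dist (T i w) (T i w) \<or> a j * r' \<le> dist (T j w') (T i w)"
      using assms i j \<open>i \<noteq> j\<close> unfolding weak_packing_def by blast
    moreover have "a i * r > 0" "a j * r' > 0" using i j \<open>r > 0\<close> \<open>r' > 0\<close> by auto
    ultimately show False using eq by auto
  qed
qed

lemma compact_PiE_UNIV: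
  fixes S :: "'i \<Rightarrow> 'a::topological_space set"
  assumes "\<And>i. compact (S i)"
  shows "compact (PiE UNIV S)"
proof -
  have "compactin (product_topology (\<lambda>i. euclidean) UNIV) (PiE UNIV S)"
    unfolding compactin_PiE using assms by simp
  then show ?thesis by (simp add: euclidean_product_topology)
qed

lemma closed_weak_packings:
  assumes "closed P"
  shows "closed {x. weak_packing P n (fst x) (snd x)}"
proof -
  have cA: "continuous_on UNIV (\<lambda>x :: (nat \<Rightarrow> real) \<times> (nat \<Rightarrow> real^2 \<Rightarrow> real^2). fst x i)" for i
    by (rule continuous_on_product_then_coordinatewise) (intro continuous_intros)
  have cT: "continuous_on UNIV (\<lambda>x :: (nat \<Rightarrow> real) \<times> (nat \<Rightarrow> real^2 \<Rightarrow> real^2). snd x i z)" for i z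
    by (rule continuous_on_product_then_coordinatewise,
        rule continuous_on_product_then_coordinatewise) (intro continuous_intros)
  have cl: "closed {x :: (nat \<Rightarrow> real) \<times> (nat \<Rightarrow> real^2 \<Rightarrow> real^2). snd x i z \<in> P}" for i z
    using closed_vimage[OF assms cT[of i z]] by (simp add: vimage_def)
  show ?thesis
    unfolding weak_packing_def Ball_def
    by (intro closed_Collect_conj closed_Collect_disj closed_Collect_all closed_Collect_imp
        open_Collect_const closed_Collect_eq closed_Collect_le cl continuous_intros cA cT)
qed

text \<open>A similarity of ratio above \<open>1\<close> would increase the diameter of \<open>P\<close>.\<close>
lemma similarity_ratio_le_1:
  fixes P :: "(real^2) set"
  assumes "compact P" "y0 \<in> P" "z0 \<in> P" "y0 \<noteq> z0"
    and T: "\<And>y z. dist (T y) (T z) = a * dist y z" "\<And>z. z \<in> P \<Longrightarrow> T z \<in> P"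
  shows "a \<le> 1"
proof -
  obtain y z where yz: "y \<in> P" "z \<in> P" and max: "\<forall>y'\<in>P. \<forall>z'\<in>P. dist y' z' \<le> dist y z"
    using diameter_compact_attained[OF assms(1)] diameter_bounded_bound[OF compact_imp_bounded[OF assms(1)]]
      assms(2) by (metis empty_iff)
  have "dist y z > 0" using max assms(2-4) by (metis dist_pos_lt less_le_trans)
  moreover have "a * dist y z \<le> 1 * dist y z" using T max yz by (metis mult_1)
  ultimately show ?thesis by (simp add: mult_le_cancel_right)
qed

text \<open>All ratios lie in \<open>[0, 1]\<close>, and \<open>T i y\<close> lies within \<open>dist y y0\<close> of \<open>T i y0 \<in> P\<close>. So the
  weak packings that vanish at the indices \<open>i \<ge> n\<close> lie in a product of compact sets, where being a
  weak packing is a closed condition and the sum of the ratios is continuous.\<close>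
lemma weak_packing_sum_attains_max:
  assumes "compact P" "y0 \<in> P" "z0 \<in> P" "y0 \<noteq> z0" and ex: "weak_packing P n a0 T0"
  obtains a T where "weak_packing P n a T"
    "\<And>b S. weak_packing P n b S \<Longrightarrow> (\<Sum>i<n. b i) \<le> (\<Sum>i<n. a i)"
proof -
  obtain R where R: "\<And>z. z \<in> P \<Longrightarrow> norm z \<le> R"
    using compact_imp_bounded[OF assms(1)] by (auto simp: bounded_iff)
  define A where "A = PiE UNIV (\<lambda>i :: nat. {0..1 :: real})"
  define B where "B = PiE UNIV (\<lambda>i :: nat. PiE UNIV (\<lambda>y. cball (0 :: real^2) (R + dist y y0)))"
  define W where "W = A \<times> B \<inter> {x. weak_packing P n (fst x) (snd x)}"
  have "compact (A \<times> B)" unfolding A_def B_def by (intro compact_Times compact_PiE_UNIV) auto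
  then have "compact W"
    unfolding W_def
    using closed_weak_packings[OF compact_imp_closed[OF assms(1)], of n] by (rule compact_Int_closed)
  have dom: "\<exists>x\<in>W. (\<Sum>i<n. fst x i) = (\<Sum>i<n. b i)" if b: "weak_packing P n b S" for b S
  proof -
    \<comment> \<open>The values at indices \<open>i \<ge> n\<close> are unconstrained and are reset to lie in the product.\<close>
    define b' where "b' = (\<lambda>i. if i < n then b i else 0)"
    define S' where "S' = (\<lambda>i y. if i < n then S i y else 0)"
    have "R \<ge> 0" using R[OF assms(2)] norm_ge_zero order_trans by blast
    have d: "\<And>y z. dist (S i y) (S i z) = b i * dist y z" and m: "\<And>z. z \<in> P \<Longrightarrow> S i z \<in> P"
      if "i < n" for i using b that by (auto simp: weak_packing_def)
    have b1: "0 \<le> b i" "b i \<le> 1" if "i < n" for i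
    proof -
      have "0 \<le> b i * dist y0 z0" by (metis d[OF that] zero_le_dist)
      then show "0 \<le> b i" using assms(4) by (simp add: zero_le_mult_iff)
      show "b i \<le> 1" using similarity_ratio_le_1[OF assms(1-4) d[OF that] m[OF that]] .
    qed
    have "norm (S i y) \<le> R + dist y y0" if "i < n" for i y
    proof -
      have "norm (S i y) \<le> norm (S i y0) + dist (S i y) (S i y0)"
        by (metis dist_norm norm_triangle_sub)
      moreover have "norm (S i y0) \<le> R" using R m[OF that] assms(2) by blast
      moreover have "b i * dist y y0 \<le> dist y y0" using b1[OF that] by (simp add: mult_left_le_one_le)
      ultimately show ?thesis using d[OF that, of y y0] by linarith
    qed
    then have "(b', S') \<in> A \<times> B"
      using b1 \<open>R \<ge> 0\<close> by (auto simp: A_def B_def b'_def S'_def)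
    moreover have "weak_packing P n b' S'"
      using b unfolding weak_packing_def b'_def S'_def by simp
    ultimately have "(b', S') \<in> W" by (simp add: W_def)
    then show ?thesis by (rule bexI[rotated]) (simp add: b'_def)
  qed
  have "continuous_on W (\<lambda>x. \<Sum>i<n. fst x i)"
    by (rule continuous_on_sum, rule continuous_on_product_then_coordinatewise)
      (intro continuous_intros)
  moreover have "W \<noteq> {}" using dom[OF ex] by blast
  ultimately obtain x where "x \<in> W" and x: "\<forall>y\<in>W. (\<Sum>i<n. fst y i) \<le> (\<Sum>i<n. fst x i)"
    using continuous_attains_sup[OF \<open>compact W\<close>, of "\<lambda>x. \<Sum>i<n. fst x i"] by blast
  show ?thesis
  proof (rule that)
    show "weak_packing P n (fst x) (snd x)" using \<open>x \<in> W\<close> by (simp add: W_def)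
    show "(\<Sum>i<n. b i) \<le> (\<Sum>i<n. fst x i)" if "weak_packing P n b S" for b S
    proof -
      obtain y where "y \<in> W" "(\<Sum>i<n. fst y i) = (\<Sum>i<n. b i)" using dom[OF \<open>weak_packing P n b S\<close>] ..
      then show ?thesis using x[rule_format, of y] by simp
    qed
  qed
qed

lemma compact_parallelogram: "compact (parallelogram p u v)"
proof -
  have "parallelogram p u v = (\<lambda>c. p + fst c *\<^sub>R u + snd c *\<^sub>R v) ` ({0..1} \<times> {0..1})"
    by (force simp: parallelogram_def)
  moreover have "compact \<dots>"
    by (intro compact_continuous_image continuous_intros compact_Times) auto
  ultimately show ?thesis by simp
qed

text \<open>A maximizing weak packing yields a packing by its pieces of positive ratio, with the same sum.
  There is at least one such piece, because the sum is at least \<open>1\<close>; halving then brings the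
  number of pieces back to \<open>n\<close>.\<close>
lemma max_packing_sum_properties:
  fixes p u v :: "real^2"
  assumes uv: "u \<noteq> v" "independent {u, v}" and "n \<ge> 1"
  defines "P \<equiv> parallelogram p u v"
  shows "achievable P n (max_packing_sum P n)"
    and "achievable P n s \<Longrightarrow> s \<le> max_packing_sum P n"
proof -
  have "p + 0 *\<^sub>R u + 0 *\<^sub>R v \<in> P" "p + 1 *\<^sub>R u + 0 *\<^sub>R v \<in> P"
    unfolding P_def parallelogram_def by fastforce+
  then have mem: "p \<in> P" "p + u \<in> P" by simp_all
  have ne: "p \<noteq> p + u" using uv(2) by (auto simp: dependent_zero)
  have "packing P {()} (\<lambda>_. 1) (\<lambda>_. id)" by (simp add: packing_def similarity_def)
  from packing_achievable[OF this] have "achievable P 1 1" by simp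
  then have "achievable P n 1"
    unfolding P_def using achievable_mono[OF uv _ _ \<open>n \<ge> 1\<close>] by simp
  then obtain a0 T0 where 0: "weak_packing P n a0 T0" and sum0: "(\<Sum>i<n. a0 i) = 1"
    by (metis achievable_iff_packing packing_imp_weak_packing)
  obtain a T where w: "weak_packing P n a T"
    and max: "\<And>b S. weak_packing P n b S \<Longrightarrow> (\<Sum>i<n. b i) \<le> (\<Sum>i<n. a i)"
    using weak_packing_sum_attains_max[OF compact_parallelogram mem[unfolded P_def] ne
        0[unfolded P_def]] unfolding P_def by blast
  define I where "I = {i. i < n \<and> a i > 0}"
  have nonneg: "a i \<ge> 0" if "i < n" for i
  proof -
    have "0 \<le> a i * dist p (p + u)"
      using w that unfolding weak_packing_def by (metis zero_le_dist)
    then show ?thesis using ne by (simp add: zero_le_mult_iff)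
  qed
  have sumI: "sum a I = (\<Sum>i<n. a i)"
    by (rule sum.mono_neutral_left) (use nonneg in \<open>force simp: I_def\<close>)+
  have "I \<noteq> {}" using max[OF 0] sum0 sumI by force
  have "finite I" "card I \<le> n" using card_mono[of "{..<n}" I] by (auto simp: I_def)
  have "achievable P (card I) (\<Sum>i<n. a i)"
    using packing_achievable[OF weak_packing_imp_packing[OF w]] \<open>finite I\<close> sumI
    by (simp add: I_def)
  then have "achievable P n (\<Sum>i<n. a i)"
    unfolding P_def
    by (rule achievable_mono[OF uv])
      (use \<open>finite I\<close> \<open>I \<noteq> {}\<close> \<open>card I \<le> n\<close> in \<open>auto simp: Suc_le_eq card_gt_0_iff\<close>)
  moreover have "s \<le> (\<Sum>i<n. a i)" if "achievable P n s" for s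
    using that max unfolding achievable_iff_packing by (auto dest: packing_imp_weak_packing)
  moreover from calculation have "max_packing_sum P n = (\<Sum>i<n. a i)"
    unfolding max_packing_sum_def achievable_def[symmetric] by (intro Greatest_equality)
  ultimately show "achievable P n (max_packing_sum P n)"
    and "achievable P n s \<Longrightarrow> s \<le> max_packing_sum P n" by simp_all
qed

section \<open>Growth of the packing excess\<close>

text \<open>The factor \<open>k/K\<close> is the ratio of the block that carries the optimal packing for \<open>k\<close>: only there
  does the grid packing gain over its standard sum \<open>K\<close>.\<close>
lemma packing_excess_growth:
  assumes uv: "u \<noteq> v" "independent {u, v}" and k: "1 \<le> k" "k \<le> K"
  shows "real k / real K * packing_excess (parallelogram p u v) k
    \<le> packing_excess (parallelogram p u v) K"
proof -
  have "achievable (parallelogram p u v) (k\<^sup>2 + 1)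
      (max_packing_sum (parallelogram p u v) (k\<^sup>2 + 1))"
    by (rule max_packing_sum_properties(1)[OF uv]) simp
  note grid = achievable_grid[OF uv this k]
  have "real K + real k / real K * (max_packing_sum (parallelogram p u v) (k\<^sup>2 + 1) - real k)
      \<le> max_packing_sum (parallelogram p u v) (K\<^sup>2 + 1)"
    by (rule max_packing_sum_properties(2)[OF uv _ grid]) simp
  then show ?thesis unfolding packing_excess_def by linarith
qed

lemma packing_excess_nonneg:
  assumes uv: "u \<noteq> v" "independent {u, v}" and "1 \<le> k"
  shows "packing_excess (parallelogram p u v) k \<ge> 0"
proof -
  have "1\<^sup>2 + 1 = (2 :: nat)" by simp
  moreover have "1 \<le> max_packing_sum (parallelogram p u v) 2"
    by (rule max_packing_sum_properties(2)[OF uv _ achievable_halves[OF uv]]) simp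
  ultimately have "packing_excess (parallelogram p u v) 1 \<ge> 0"
    unfolding packing_excess_def by (simp only:)
  then have "0 \<le> real 1 / real k * packing_excess (parallelogram p u v) 1" by simp
  also have "\<dots> \<le> packing_excess (parallelogram p u v) k"
    using packing_excess_growth[OF uv] \<open>1 \<le> k\<close> by blast
  finally show ?thesis .
qed

lemma nonsummable_of_harmonic_growth:
  fixes e :: "nat \<Rightarrow> real"
  assumes growth: "\<And>K. k \<le> K \<Longrightarrow> real k / real K * e k \<le> e K"
    and k: "1 \<le> k" and pos: "e k > 0"
  shows "\<not> summable (\<lambda>n. e (Suc n))"
proof
  assume "summable (\<lambda>n. e (Suc n))"
  then have sum: "summable e" by (simp add: summable_Suc_iff)
  have "summable (\<lambda>n. (real k * e k) * inverse (of_nat n :: real))"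
  proof (rule summable_comparison_test'[OF sum])
    fix K assume "k \<le> K"
    then show "norm ((real k * e k) * inverse (of_nat K :: real)) \<le> e K"
      using growth[of K] pos by (simp add: field_simps)
  qed
  then have "summable (\<lambda>n. inverse (of_nat n :: real))"
    using k pos by (simp add: summable_cmult_iff)
  then show False using not_summable_harmonic by blast
qed

theorem mainTheorem4:
  fixes x :: real and P :: "(real^2) set"
  assumes "x > 0" and "parallelogram_with_sides 1 x P"
  shows "((\<forall>k::nat. k \<ge> 1 \<longrightarrow> max_packing_sum P (k^2 + 1) = real k) \<longleftrightarrow>
            summable (\<lambda>k::nat. packing_excess P (Suc k)))
       \<and> (infinite {k::nat. k \<ge> 1 \<and> max_packing_sum P (k^2 + 1) = real k} \<longrightarrow>
            (\<forall>k::nat. k \<ge> 1 \<longrightarrow> max_packing_sum P (k^2 + 1) = real k))"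
proof -
  obtain p u v where uv: "u \<noteq> v" "independent {u, v}" and P: "P = parallelogram p u v"
    using assms(2) by (auto simp: parallelogram_with_sides_def)
  let ?e = "packing_excess P"
  have iff: "max_packing_sum P (k^2 + 1) = real k \<longleftrightarrow> ?e k = 0" for k
    by (simp add: packing_excess_def)
  have growth: "real k / real K * ?e k \<le> ?e K" if "1 \<le> k" "k \<le> K" for k K
    unfolding P using packing_excess_growth[OF uv that] .
  have nonneg: "?e k \<ge> 0" if "1 \<le> k" for k
    unfolding P using packing_excess_nonneg[OF uv that] .
  show ?thesis
    unfolding iff
  proof (intro conjI iffI impI allI)
    assume "\<forall>k\<ge>1. ?e k = 0"
    then show "summable (\<lambda>k. ?e (Suc k))" by simp
  next
    fix k :: nat assume "summable (\<lambda>k. ?e (Suc k))" and k: "1 \<le> k"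
    then have "\<not> ?e k > 0" using nonsummable_of_harmonic_growth[of k ?e] growth by blast
    then show "?e k = 0" using nonneg[OF k] by simp
  next
    fix k :: nat assume "infinite {k. k \<ge> 1 \<and> ?e k = 0}" and k: "1 \<le> k"
    then have "\<exists>K\<ge>k. K \<in> {k. k \<ge> 1 \<and> ?e k = 0}"
      unfolding infinite_nat_iff_unbounded_le by blast
    then obtain K where "k \<le> K" "?e K = 0" by blast
    then have "real k / real K * ?e k \<le> 0" using growth[OF k] by force
    moreover have "real k / real K > 0" using k \<open>k \<le> K\<close> by simp
    ultimately have "?e k \<le> 0" by (simp only: mult_le_0_iff) linarith
    then show "?e k = 0" using nonneg[OF k] by simp
  qed
qed

end
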